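(* Let $A=(Q,\Sigma,q_0,q_f,\delta)$ be an $\varepsilon$NFA with $n=|Q|$ states and $m=|\delta|$ transitions, and let $w\in\Sigma^*$. The subsequence matching problem (decide whether some $u$ with $u\preceq_{\mathrm{sub}} w$ satisfies $u\in\mathcal{L}(A)$) can be solved in time $O(|w|\,(n|\Sigma|+m))$, and the supersequence matching problem (decide whether some $u$ with $u\preceq_{\mathrm{sup}} w$ satisfies $u\in\mathcal{L}(A)$) can be solved in time $O(|w|\,m)$.
   Context: An $\varepsilon$NFA is a tuple $A=(Q,\Sigma,q_0,q_f,\delta)$ with finite state set $Q$, finite alphabet $\Sigma$, a single initial state $q_0$, a single final state $q_f$, and transitions $\delta\subseteq Q\times(\Sigma\cup\{\varepsilon\})\times Q$. A run on $w$ is a path from $q_0$ whose concatenated labels (ignoring $\varepsilon$) equal $w$; it is accepting if it ends in $q_f$; $\mathcal{L}(A)$ is the set of strings with an accepting run. The size of $A$ is $m=|\delta|$. Standing assumptions: $A$ is trimmed (every state is reachable from $q_0$ and can reach $q_f$), and every symbol of $\Sigma$ labels at least one transition (so $n$ and $|\Sigma|$ are $O(m)$). Relations: $u\preceq_{\mathrm{sub}} w$ ($u$ is a subsequence of $w$) iff $u=w[j_1]w[j_2]\cdots w[j_{|u|}]$ for some $1\le j_1<\dots<j_{|u|}\le|w|$; $u\preceq_{\mathrm{sup}} w$ iff $w\preceq_{\mathrm{sub}} u$. Model of computation: unit-cost word RAM with logarithmic word size; states and symbols are integers $Q=\{1,\dots,n\}$, $\Sigma=\{1,\dots,|\Sigma|\}$.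 *)

theory Defs
  imports Complex_Main "HOL-Library.Sublist"
begin

section \<open>Nondeterministic automata with empty transitions\<close>

text \<open>The label \<open>None\<close> stands for the empty word, \<open>Some a\<close> for the symbol \<open>a\<close>.\<close>

record ('q, 'a) enfa =
  states :: "'q set"
  alphabet :: "'a set"
  initial :: 'q
  final :: 'q
  delta :: "('q \<times> 'a option \<times> 'q) set"

definition is_enfa :: "('q, 'a) enfa \<Rightarrow> bool" where
  "is_enfa A \<longleftrightarrow>
     finite (states A) \<and> finite (alphabet A) \<and>
     initial A \<in> states A \<and> final A \<in> states A \<and>
     delta A \<subseteq> states A \<times> (insert None (Some ` alphabet A)) \<times> states A"

fun label_word :: "'a option \<Rightarrow> 'a list" where
  "label_word None = []"
| "label_word (Some a) = [a]"

inductive path :: "('q, 'a) enfa \<Rightarrow> 'q \<Rightarrow> 'a list \<Rightarrow> 'q \<Rightarrow> bool" for A where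
  path_refl: "p \<in> states A \<Longrightarrow> path A p [] p"
| path_step: "(p, l, q) \<in> delta A \<Longrightarrow> path A q u r \<Longrightarrow> path A p (label_word l @ u) r"

definition language :: "('q, 'a) enfa \<Rightarrow> 'a list set" where
  "language A = {u. path A (initial A) u (final A)}"

definition trimmed :: "('q, 'a) enfa \<Rightarrow> bool" where
  "trimmed A \<longleftrightarrow>
     (\<forall>q\<in>states A. (\<exists>u. path A (initial A) u q) \<and> (\<exists>v. path A q v (final A)))"

definition all_symbols_used :: "('q, 'a) enfa \<Rightarrow> bool" where
  "all_symbols_used A \<longleftrightarrow> (\<forall>a\<in>alphabet A. \<exists>p q. (p, Some a, q) \<in> delta A)"

definition integer_enfa :: "(nat, nat) enfa \<Rightarrow> bool" where
  "integer_enfa A \<longleftrightarrow>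
     states A = {1..card (states A)} \<and> alphabet A = {1..card (alphabet A)}"


section \<open>Subsequence and supersequence matching\<close>

definition subsequence_matching :: "('q, 'a) enfa \<Rightarrow> 'a list \<Rightarrow> bool" where
  "subsequence_matching A w \<longleftrightarrow> (\<exists>u. subseq u w \<and> u \<in> language A)"

definition supersequence_matching :: "('q, 'a) enfa \<Rightarrow> 'a list \<Rightarrow> bool" where
  "supersequence_matching A w \<longleftrightarrow> (\<exists>u. subseq w u \<and> u \<in> language A)"


section \<open>Unit-cost word RAM\<close>

text \<open>
  Words of \<open>b\<close> bits are the natural numbers below \<open>2 ^ b\<close>, and all arithmetic is
  modulo \<open>2 ^ b\<close>. The word length is a parameter of the semantics and not a type, because
  it depends on the input size. The machine has a memory addressed by words; since a program
  is a finite list of instructions, it mentions only a constant number of registers.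
\<close>

datatype operation = Add | Sub | Mul | Div | Mod | And | Or | Xor | ShiftL | ShiftR

text \<open>Division by zero yields \<open>0\<close>, and \<open>x mod 0 = x\<close>, as in HOL.\<close>

fun eval_op :: "nat \<Rightarrow> operation \<Rightarrow> nat \<Rightarrow> nat \<Rightarrow> nat" where
  "eval_op b Add x y = (x + y) mod 2 ^ b"
| "eval_op b Sub x y = nat ((int x - int y) mod 2 ^ b)"
| "eval_op b Mul x y = (x * y) mod 2 ^ b"
| "eval_op b Div x y = (x div y) mod 2 ^ b"
| "eval_op b Mod x y = (x mod y) mod 2 ^ b"
| "eval_op b And x y = Bit_Operations.and x y mod 2 ^ b"
| "eval_op b Or x y = Bit_Operations.or x y mod 2 ^ b"
| "eval_op b Xor x y = Bit_Operations.xor x y mod 2 ^ b"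
| "eval_op b ShiftL x y = push_bit y x mod 2 ^ b"
| "eval_op b ShiftR x y = drop_bit y x mod 2 ^ b"

text \<open>Register arguments come destination first; jump targets are absolute positions.\<close>

datatype instr =
    Const nat nat                \<comment> \<open>\<open>Const r k\<close>: \<open>r := k\<close>\<close>
  | Op operation nat nat nat     \<comment> \<open>\<open>Op f r s t\<close>: \<open>r := f s t\<close>\<close>
  | Load nat nat                 \<comment> \<open>\<open>Load r s\<close>: \<open>r := mem[s]\<close>\<close>
  | Store nat nat                \<comment> \<open>\<open>Store r s\<close>: \<open>mem[r] := s\<close>\<close>
  | Jump nat
  | JumpEq nat nat nat           \<comment> \<open>\<open>JumpEq r s l\<close>: jump to \<open>l\<close> if \<open>r = s\<close>\<close>
  | JumpLess nat nat nat         \<comment> \<open>\<open>JumpLess r s l\<close>: jump to \<open>l\<close> if \<open>r < s\<close>\<close>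
  | Halt

record config =
  pc :: nat
  reg :: "nat \<Rightarrow> nat"
  mem :: "nat \<Rightarrow> nat"

fun exec :: "nat \<Rightarrow> instr \<Rightarrow> config \<Rightarrow> config" where
  "exec b (Const r k) c = c\<lparr>pc := pc c + 1, reg := (reg c)(r := k mod 2 ^ b)\<rparr>"
| "exec b (Op f r s t) c =
     c\<lparr>pc := pc c + 1, reg := (reg c)(r := eval_op b f (reg c s) (reg c t))\<rparr>"
| "exec b (Load r s) c = c\<lparr>pc := pc c + 1, reg := (reg c)(r := mem c (reg c s))\<rparr>"
| "exec b (Store r s) c = c\<lparr>pc := pc c + 1, mem := (mem c)(reg c r := reg c s)\<rparr>"
| "exec b (Jump l) c = c\<lparr>pc := l\<rparr>"
| "exec b (JumpEq r s l) c = c\<lparr>pc := (if reg c r = reg c s then l else pc c + 1)\<rparr>"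
| "exec b (JumpLess r s l) c = c\<lparr>pc := (if reg c r < reg c s then l else pc c + 1)\<rparr>"
| "exec b Halt c = c"

text \<open>A program counter outside the program leaves the machine stuck without halting.\<close>

definition step :: "nat \<Rightarrow> instr list \<Rightarrow> config \<Rightarrow> config" where
  "step b P c = (if pc c < length P then exec b (P ! pc c) c else c)"

definition halted :: "instr list \<Rightarrow> config \<Rightarrow> bool" where
  "halted P c \<longleftrightarrow> pc c < length P \<and> P ! pc c = Halt"

definition initial_config :: "nat list \<Rightarrow> config" where
  "initial_config x =
     \<lparr>pc = 0, reg = (\<lambda>_. 0), mem = (\<lambda>i. if i < length x then x ! i else 0)\<rparr>"

text \<open>The answer is returned in register \<open>0\<close>: \<open>1\<close> for yes and \<open>0\<close> for no.\<close>

definition answers_within :: "nat \<Rightarrow> instr list \<Rightarrow> nat list \<Rightarrow> bool \<Rightarrow> nat \<Rightarrow> bool" where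
  "answers_within b P x v T \<longleftrightarrow>
     (\<exists>t\<le>T. let c = (step b P ^^ t) (initial_config x)
             in halted P c \<and> reg c 0 = (if v then 1 else 0))"


section \<open>Solving a matching problem in a given time\<close>

text \<open>
  Symbols are at least \<open>1\<close>, so \<open>0\<close> can encode the empty label. The transitions are given
  as a list \<open>ts\<close> without repetitions, in an arbitrary order.
\<close>

fun encode_transition :: "nat \<times> nat option \<times> nat \<Rightarrow> nat list" where
  "encode_transition (p, l, q) = [p, (case l of None \<Rightarrow> 0 | Some a \<Rightarrow> a), q]"

definition encode ::
  "(nat, nat) enfa \<Rightarrow> (nat \<times> nat option \<times> nat) list \<Rightarrow> nat list \<Rightarrow> nat list" where
  "encode A ts w =
     [card (states A), card (alphabet A), initial A, final A, length ts, length w] @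
     concat (map encode_transition ts) @ w"

definition matching_instance :: "(nat, nat) enfa \<Rightarrow> nat list \<Rightarrow> bool" where
  "matching_instance A w \<longleftrightarrow>
     is_enfa A \<and> integer_enfa A \<and> trimmed A \<and> all_symbols_used A \<and> set w \<subseteq> alphabet A"

text \<open>
  \<open>solvable_in_time D f\<close>: a single program solves the problem \<open>D\<close> in time \<open>O(f)\<close>. The
  machine has logarithmic word length: the program has to work for every word length that is
  at least \<open>c\<close> times the logarithm of the input size (in words), for some constant \<open>c\<close>.
\<close>

definition solvable_in_time ::
  "((nat, nat) enfa \<Rightarrow> nat list \<Rightarrow> bool) \<Rightarrow> ((nat, nat) enfa \<Rightarrow> nat list \<Rightarrow> nat) \<Rightarrow> bool" where
  "solvable_in_time D f \<longleftrightarrow>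
     (\<exists>(P :: instr list) (c :: nat) (C :: nat). \<forall>A w ts b.
        matching_instance A w \<longrightarrow>
        distinct ts \<longrightarrow> set ts = delta A \<longrightarrow>
        real b \<ge> real c * log 2 (real (length (encode A ts w))) \<longrightarrow>
        answers_within b P (encode A ts w) (D A w) (C * f A w))"

text \<open>
  A bound \<open>|w| * m\<close> read literally would be \<open>0\<close> for the empty word, which no machine can
  meet. Hence vanishing factors are replaced by \<open>1\<close>. If \<open>w\<close> is nonempty, this changes
  nothing: its symbols label transitions, so \<open>m \<ge> 1\<close>.
\<close>

definition subsequence_bound :: "('q, 'a) enfa \<Rightarrow> 'a list \<Rightarrow> nat" where
  "subsequence_bound A w =
     max 1 (length w) * max 1 (card (states A) * card (alphabet A) + card (delta A))"

definition supersequence_bound :: "('q, 'a) enfa \<Rightarrow> 'a list \<Rightarrow> nat" where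
  "supersequence_bound A w = max 1 (length w) * max 1 (card (delta A))"

end

theory Submission
  imports Defs
begin

text \<open>
  Both problems are reachability questions in the product of the automaton with the positions
  \<open>0, \<dots>, |w|\<close> of the word. A step follows a transition and either stays at the current position
  (for an empty label or, when matching supersequences, for any label) or advances over an equal
  letter; when matching subsequences, letters of \<open>w\<close> may also be skipped. The product has
  \<open>n (|w| + 1)\<close> nodes and \<open>O((n + m) (|w| + 1))\<close> edges, and \<open>n \<le> m + 1\<close> since \<open>A\<close> is trimmed, so
  depth-first search takes time \<open>O(|w| m)\<close> in both cases. The search needs no initialization: all
  memory behind the input is \<open>0\<close>, which is read as ``not visited'' and ``empty list''.
\<close>

section \<open>Product graph\<close>

inductive_set product :: "bool \<Rightarrow> ('q, 'a) enfa \<Rightarrow> 'a list \<Rightarrow> (('q \<times> nat) \<times> ('q \<times> nat)) set"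
  for super :: bool and A w where
  stay: "(p, l, r) \<in> delta A \<Longrightarrow> i \<le> length w \<Longrightarrow> super \<or> l = None \<Longrightarrow>
    ((p, i), (r, i)) \<in> product super A w"
| read: "(p, Some a, r) \<in> delta A \<Longrightarrow> i < length w \<Longrightarrow> w ! i = a \<Longrightarrow>
  ((p, i), (r, Suc i)) \<in> product super A w"
| skip: "p \<in> states A \<Longrightarrow> i < length w \<Longrightarrow> \<not> super \<Longrightarrow> ((p, i), (p, Suc i)) \<in> product super A w"

definition matching :: "bool \<Rightarrow> ('q, 'a) enfa \<Rightarrow> 'a list \<Rightarrow> bool" where
  "matching super A w = (if super then supersequence_matching A w else subsequence_matching A w)"

section \<open>Paths in the product graph and matching words\<close>

lemma product_skip:
  assumes "p \<in> states A" "i \<le> j" "j \<le> length w"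
  shows "((p, i), (p, j)) \<in> (product False A w)\<^sup>*"
  using assms(2,3)
proof (induction j rule: dec_induct)
  case (step j)
  then show ?case using skip[of p A j w False] assms(1) by (auto intro: rtrancl_into_rtrancl)
qed simp

text \<open>Induction along the path: before a symbol is read, skip edges cross the letters of
  \<open>w\<close> in front of its occurrence; where the path ends, skip edges cross the remaining
  letters.\<close>

lemma product_complete_sub:
  assumes "is_enfa A" "path A p u r" "subseq u (drop i w)" "i \<le> length w"
  shows "((p, i), (r, length w)) \<in> (product False A w)\<^sup>*"
  using assms(2-4)
proof (induction arbitrary: i rule: path.induct)
  case (path_refl p)
  then show ?case by (simp add: product_skip)
next
  case (path_step p l q u r)
  show ?case
  proof (cases l)
    case None
    then show ?thesis using path_step stay[of p l q A i w False]
      by (auto intro: converse_rtrancl_into_rtrancl)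
  next
    case (Some a)
    obtain xs ys where xy: "drop i w = xs @ a # ys" "subseq u ys"
      using path_step.prems Some by (auto elim: list_emb_ConsD dest!: list_emb_ConsD)
    define j where "j = i + length xs"
    have "length w - i = length xs + Suc (length ys)"
      using arg_cong[OF xy(1), of length] by simp
    then have j: "j < length w" "i \<le> j" by (auto simp: j_def)
    have "drop j w = drop (length xs) (drop i w)" by (simp add: j_def add.commute)
    then have d: "drop j w = a # ys" using xy(1) by simp
    then have "w ! j = a" "drop (Suc j) w = ys" using j
      by (simp_all add: Cons_nth_drop_Suc[symmetric])
    moreover have "p \<in> states A" using path_step assms(1) by (auto simp: is_enfa_def)
    ultimately show ?thesis
      using product_skip[of p A i j w] read[of p a q A j w False] path_step.IH[of "Suc j"]
        path_step.hyps j xy(2) Some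
      by (meson converse_rtrancl_into_rtrancl less_imp_le rtrancl_trans Suc_leI)
  qed
qed

text \<open>A transition stays whenever the remaining suffix of \<open>w\<close> still embeds into
  the word of the rest of the path. Otherwise its label has to be the next letter of
  \<open>w\<close>, which is read.\<close>

lemma product_complete_sup:
  assumes "path A p u r" "subseq (drop i w) u" "i \<le> length w"
  shows "((p, i), (r, length w)) \<in> (product True A w)\<^sup>*"
  using assms
proof (induction arbitrary: i rule: path.induct)
  case (path_refl p)
  then have "drop i w = []" by (cases "drop i w") auto
  with path_refl have "i = length w" by simp
  then show ?case by simp
next
  case (path_step p l q u r)
  show ?case
  proof (cases "subseq (drop i w) u")
    case True
    then show ?thesis using path_step stay[of p l q A i w True]
      by (auto intro: converse_rtrancl_into_rtrancl)
  next
    case False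
    then obtain a where a: "l = Some a" using path_step.prems by (cases l) auto
    have i: "i < length w" using False path_step.prems(2) by (cases "i = length w") auto
    then have "w ! i = a" "subseq (drop (Suc i) w) u"
      using path_step.prems(1) a False
      by (auto simp: Cons_nth_drop_Suc[symmetric] split: if_splits)
    then show ?thesis using read[of p a q A i w True] path_step a i
      by (meson Suc_leI converse_rtrancl_into_rtrancl)
  qed
qed

text \<open>Induction backwards from the target: stay and read edges prepend their label to the word
  found so far, skip edges leave it unchanged.\<close>

lemma product_sound:
  assumes "((p, i), (r, length w)) \<in> (product super A w)\<^sup>*" "r \<in> states A"
  shows "\<exists>u. path A p u r \<and> (if super then subseq (drop i w) u else subseq u (drop i w))"
  using assms(1)
proof (induction "(p, i)" arbitrary: p i rule: converse_rtrancl_induct)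
  case base
  then show ?case using path.path_refl[OF assms(2)] by (intro exI[of _ "[]"]) auto
next
  case (step z)
  obtain q j where z: "z = (q, j)" by (cases z)
  with step obtain u where u: "path A q u r"
      "if super then subseq (drop j w) u else subseq u (drop j w)"
    by auto
  from step(1)[unfolded z] show ?case
  proof cases
    case (stay l)
    then show ?thesis using u path.path_step[OF stay(2) u(1)]
      by (intro exI[of _ "label_word l @ u"]) (auto intro: list_emb_append2)
  next
    case (read a)
    then show ?thesis using u path.path_step[OF read(2) u(1)]
      by (intro exI[of _ "a # u"]) (auto simp: Cons_nth_drop_Suc[symmetric])
  next
    case skip
    then show ?thesis using u
      by (intro exI[of _ "u"]) (auto simp: Cons_nth_drop_Suc[symmetric])
  qed
qed

lemma matching_iff:
  assumes "is_enfa A"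
  shows "matching super A w \<longleftrightarrow> ((initial A, 0), (final A, length w)) \<in> (product super A w)\<^sup>*"
proof
  assume "matching super A w"
  then show "((initial A, 0), (final A, length w)) \<in> (product super A w)\<^sup>*"
    using product_complete_sub[OF assms, of _ _ _ 0] product_complete_sup[of A _ _ _ 0]
    by (auto simp: matching_def supersequence_matching_def subsequence_matching_def language_def
        split: if_splits)
next
  assume "((initial A, 0), (final A, length w)) \<in> (product super A w)\<^sup>*"
  from product_sound[OF this] assms show "matching super A w"
    by (auto simp: matching_def supersequence_matching_def subsequence_matching_def language_def
        is_enfa_def split: if_splits)
qed

section \<open>Number of states of a trimmed automaton\<close>

lemma path_target: "path A p u r \<Longrightarrow> r = p \<or> r \<in> (\<lambda>(p, l, q). q) ` delta A"
  by (induction rule: path.induct) (auto intro: rev_image_eqI)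

text \<open>Being reachable, every state except possibly the initial one is the target of a
  transition.\<close>

lemma card_states_le:
  assumes "trimmed A" "finite (delta A)"
  shows "card (states A) \<le> card (delta A) + 1"
proof -
  have "states A \<subseteq> insert (initial A) ((\<lambda>(p, l, q). q) ` delta A)"
    using assms(1) by (auto simp: trimmed_def dest: path_target)
  then have "card (states A) \<le> card (insert (initial A) ((\<lambda>(p, l, q). q) ` delta A))"
    using assms(2) by (intro card_mono) auto
  also have "\<dots> \<le> Suc (card ((\<lambda>(p, l, q). q) ` delta A))" by (rule card_insert_le_m1) auto
  also have "\<dots> \<le> card (delta A) + 1" using card_image_le[OF assms(2)] by simp
  finally show ?thesis .
qed

section \<open>Bounded execution\<close>

text \<open>An upper bound on the steps rather than an exact count, so that branches of different
  length share one bound and bounds add up along consecutive blocks.\<close>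

definition leads :: "nat \<Rightarrow> instr list \<Rightarrow> nat \<Rightarrow> config \<Rightarrow> (config \<Rightarrow> bool) \<Rightarrow> bool" where
  "leads b P k c Q \<longleftrightarrow> (\<exists>t\<le>k. Q ((step b P ^^ t) c))"

lemma leads_trans:
  assumes "leads b P k c Q" "\<And>c'. Q c' \<Longrightarrow> leads b P k' c' R" "k + k' \<le> K"
  shows "leads b P K c R"
proof -
  obtain t where t: "t \<le> k" "Q ((step b P ^^ t) c)" using assms(1) by (auto simp: leads_def)
  obtain t' where t': "t' \<le> k'" "R ((step b P ^^ t') ((step b P ^^ t) c))"
    using assms(2)[OF t(2)] by (auto simp: leads_def)
  have "R ((step b P ^^ (t' + t)) c)" using t' by (simp add: funpow_add)
  then show ?thesis using t t' assms(3) unfolding leads_def by (intro exI[of _ "t' + t"]) simp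
qed

lemma leads_mono: "leads b P k c Q \<Longrightarrow> k \<le> K \<Longrightarrow> (\<And>c. Q c \<Longrightarrow> R c) \<Longrightarrow> leads b P K c R"
  unfolding leads_def by (meson le_trans)

lemma leads_refl: "Q c \<Longrightarrow> leads b P k c Q"
  unfolding leads_def by (intro exI[of _ 0]) simp

text \<open>Iterates \<open>step\<close>, but unfolds from the first step on, so that the simplifier
  executes the program symbolically on the current configuration.\<close>

fun run :: "nat \<Rightarrow> instr list \<Rightarrow> nat \<Rightarrow> config \<Rightarrow> config" where
  "run b P 0 c = c"
| "run b P (Suc k) c = run b P k (step b P c)"

lemma run_numeral: "run b P (numeral k) c = run b P (pred_numeral k) (step b P c)"
  by (simp add: numeral_eq_Suc)

lemma run_eq: "run b P k c = (step b P ^^ k) c"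
  by (induction k arbitrary: c) (simp_all add: funpow_swap1)

lemma leads_run: "leads b P k' (run b P k c) Q \<Longrightarrow> k + k' \<le> K \<Longrightarrow> leads b P K c Q"
  by (rule leads_trans[where k = k and Q = "\<lambda>c'. c' = run b P k c"])
    (auto simp: leads_def run_eq)

lemma leads_run0: "Q (run b P k c) \<Longrightarrow> leads b P k c Q"
  using leads_run[OF leads_refl, where k' = 0] by simp

section \<open>The machine program\<close>

text \<open>
  Parameter \<open>F\<close> is \<open>1\<close> for supersequence and \<open>0\<close> for subsequence matching.

  Let \<open>L\<close> be the length of the input and \<open>S = |w| + 2\<close>. Address \<open>L + q S\<close> holds the head of
  the list of transitions leaving \<open>q\<close>; the links of these lists overwrite the sources of the
  transitions. Address \<open>L + q S + i + 1\<close> represents the node \<open>(q, i)\<close>: it holds \<open>0\<close> until the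
  node is visited and then the address of the node below it on the stack, or \<open>1\<close> at the bottom.
  Popping keeps this value, so it also marks the node as visited.

  Registers: \<open>0\<close> and \<open>1\<close> hold the constants \<open>0\<close> and \<open>1\<close>, \<open>2\<close> holds \<open>L\<close>, \<open>3\<close> holds \<open>S\<close>,
  \<open>4\<close> the top of the stack, \<open>5\<close> holds \<open>5 + 3 m\<close> (so that letter \<open>i\<close>, counted from \<open>0\<close>, is at
  distance \<open>i + 1\<close>), \<open>6\<close> holds \<open>F\<close>, \<open>7\<close> the current transition, \<open>8\<close> and \<open>9\<close> the values
  \<open>i + 1\<close> and letter \<open>i\<close> of the popped node,
  \<open>10\<close> the node to visit and \<open>12\<close> a label.
\<close>

definition prog :: "nat \<Rightarrow> instr list" where
  "prog F =
    [Const 1 1, Const 6 F, Const 14 3, Const 11 4, Load 5 11, Op Mul 5 5 14, Const 11 5,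
     Load 3 11, Op Add 5 5 11, Op Add 2 5 3, Op Add 2 2 1, Const 11 2, Op Add 3 3 11, Const 7 6,
     \<comment> \<open>14: loop over the transitions, prepending each to the list of its source\<close>
     JumpLess 5 7 23, Load 11 7, Op Mul 11 11 3, Op Add 11 11 2, Load 12 11, Store 7 12,
     Store 11 7, Op Add 7 7 14, Jump 14,
     \<comment> \<open>23: push the node of the initial state\<close>
     Const 11 2, Load 10 11, Op Mul 10 10 3, Op Add 10 10 2, Op Add 10 10 1, Store 10 1,
     Op Add 4 10 0,
     \<comment> \<open>30: pop a node\<close>
     JumpEq 4 1 69, Op Sub 8 4 2, Op Mod 8 8 3, Op Sub 7 4 8, Load 7 7, Op Add 9 5 8, Load 9 9,
     Op Add 10 4 1, Load 4 4, JumpEq 6 1 45, JumpEq 9 0 45,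
     Load 11 10, JumpLess 0 11 45, Store 10 4, Op Add 4 10 0,
     \<comment> \<open>45: loop over the transitions leaving the popped node; from 53 on, stay\<close>
     JumpEq 7 0 30, Op Add 11 7 1, Load 12 11, Op Add 11 11 1, Load 10 11, Op Mul 10 10 3,
     Op Add 10 10 2, Op Add 10 10 8, JumpEq 6 1 55, JumpLess 0 12 59,
     Load 11 10, JumpLess 0 11 59, Store 10 4, Op Add 4 10 0,
     \<comment> \<open>59: read\<close>
     JumpEq 12 0 67, JumpEq 12 9 62, Jump 67, Op Add 10 10 1,
     Load 11 10, JumpLess 0 11 67, Store 10 4, Op Add 4 10 0,
     \<comment> \<open>67: next transition\<close>
     Load 7 7, Jump 45,
     \<comment> \<open>69: look up the node of the final state\<close>
     Const 11 3, Load 10 11, Op Mul 10 10 3, Op Add 10 10 2, Op Add 10 10 3, Op Sub 10 10 1,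
     Load 11 10, JumpEq 11 0 78, Const 0 1, Halt]"

text \<open>Turns the definition of a concrete list into one lookup equation per position.\<close>

lemma nth_enumerate: "xs = ys \<Longrightarrow> \<forall>(i, x)\<in>set (enumerate 0 ys). xs ! i = x"
  by (auto simp: in_set_enumerate_eq)

text \<open>The second pass turns the indices into numerals, the form that symbolic execution produces.\<close>

lemmas prog_nth = nth_enumerate[OF prog_def, simplified,
  simplified numeral_2_eq_2[symmetric] Suc_numeral, simplified]

lemma length_prog: "length (prog F) = 79"
  by (simp add: prog_def)

lemma eval_Add: "x + y < 2 ^ b \<Longrightarrow> eval_op b Add x y = x + y"
  and eval_Mul: "x * y < 2 ^ b \<Longrightarrow> eval_op b Mul x y = x * y"
  by simp_all

lemma eval_Sub: "y \<le> x \<Longrightarrow> x < 2 ^ b \<Longrightarrow> eval_op b Sub x y = x - y"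
  by (simp add: nat_mod_distrib flip: of_nat_diff)

lemma eval_Mod: "x < 2 ^ b \<Longrightarrow> eval_op b Mod x y = x mod y"
  by (simp) (metis mod_less le_less_trans mod_less_eq_dividend)

lemma step_eq: "pc c < length P \<Longrightarrow> step b P c = exec b (P ! pc c) c"
  by (simp add: step_def)

lemmas exec_simps = run_numeral step_eq length_prog prog_nth numeral_2_eq_2[symmetric]

section \<open>Memory contents\<close>

text \<open>A linked list with entry pointer \<open>e\<close> and end marker \<open>s\<close>;
  \<open>M x\<close> is the link stored at \<open>x\<close>. The marker is \<open>0\<close> for
  lists of transitions and \<open>1\<close> for the stack.\<close>

fun chain :: "nat \<Rightarrow> (nat \<Rightarrow> nat) \<Rightarrow> nat \<Rightarrow> nat list \<Rightarrow> bool" where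
  "chain s M e [] \<longleftrightarrow> e = s"
| "chain s M e (x # xs) \<longleftrightarrow> e = x \<and> x \<noteq> s \<and> chain s M (M x) xs"

lemma chain_cong: "(\<And>x. x \<in> set xs \<Longrightarrow> M x = M' x) \<Longrightarrow> chain s M e xs \<longleftrightarrow> chain s M' e xs"
  by (induction xs arbitrary: e) auto

lemma nth_encode:
  "encode A ts w ! 2 = initial A" "encode A ts w ! 3 = final A"
  "encode A ts w ! 4 = length ts" "encode A ts w ! 5 = length w"
  by (simp_all add: encode_def)

lemma length_concat_encode: "length (concat (map encode_transition ts)) = 3 * length ts"
  by (induction ts) (auto split: prod.splits)

lemma length_encode: "length (encode A ts w) = 6 + 3 * length ts + length w"
  using length_concat_encode[of ts] by (simp add: encode_def)

lemma nth_concat_encode: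
  "j < length ts \<Longrightarrow> d < 3 \<Longrightarrow>
    concat (map encode_transition ts) ! (3 * j + d) =
    encode_transition (ts ! j) ! d"
proof (induction ts arbitrary: j)
  case (Cons t ts)
  have [simp]: "length (encode_transition t) = 3" by (cases t) auto
  show ?case
  proof (cases j)
    case (Suc i)
    then show ?thesis using Cons by (simp add: nth_append)
  qed (use Cons in \<open>simp add: nth_append\<close>)
qed simp

lemma nth_encode_transition:
  assumes "j < length ts" "d < 3"
  shows "encode A ts w ! (6 + 3 * j + d) = encode_transition (ts ! j) ! d"
proof -
  have "encode A ts w ! (6 + (3 * j + d)) = (concat (map encode_transition ts) @ w) ! (3 * j + d)"
    by (simp add: encode_def eval_nat_numeral)
  then show ?thesis
    using assms nth_concat_encode[OF assms] length_concat_encode[of ts]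
    by (simp add: nth_append add.assoc)
qed

lemma nth_encode_word:
  assumes "i < length w"
  shows "encode A ts w ! (6 + 3 * length ts + i) = w ! i"
proof -
  have "encode A ts w ! (6 + (3 * length ts + i)) =
    (concat (map encode_transition ts) @ w) ! (3 * length ts + i)"
    by (simp add: encode_def eval_nat_numeral)
  then show ?thesis
    using length_concat_encode[of ts] by (simp add: nth_append add.assoc)
qed

section \<open>Memory layout and absence of overflow\<close>

locale machine =
  fixes A :: "(nat, nat) enfa" and w :: "nat list" and ts :: "(nat \<times> nat option \<times> nat) list"
    and b :: nat and super :: bool
  assumes inst: "matching_instance A w"
    and ts: "distinct ts" "set ts = delta A"
    and word_length: "(length (encode A ts w))\<^sup>2 \<le> 2 ^ b"
begin

abbreviation "m \<equiv> length ts"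
definition "L = 6 + 3 * m + length w"
definition "S = length w + 2"
definition "cell q k = L + q * S + k"
definition "adr v = cell (fst v) (Suc (snd v))"
definition "V = states A \<times> {..length w}"
definition "src j = fst (ts ! j)"
definition "lab j = (case fst (snd (ts ! j)) of None \<Rightarrow> 0 | Some a \<Rightarrow> a)"
definition "tgt j = snd (snd (ts ! j))"
text \<open>
  The memory cell behind the word is the unused head for state \<open>0\<close>, so reading letter \<open>|w|\<close>
  gives \<open>0\<close>, which is no symbol.
\<close>

definition "letter i = (if i < length w then w ! i else 0)"
text \<open>Reversed, as the machine prepends each transition to the list of its source.\<close>

definition "out j q = rev (filter (\<lambda>i. src i = q) [0..<j])"
abbreviation "ptr j \<equiv> 6 + 3 * j"
definition flag :: nat where "flag = (if super then 1 else 0)"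
abbreviation "P \<equiv> prog flag"

lemma enfa: "is_enfa A" and states_eq: "states A = {1..card (states A)}"
  and alphabet_eq: "alphabet A = {1..card (alphabet A)}" and word: "set w \<subseteq> alphabet A"
  using inst unfolding matching_instance_def integer_enfa_def by blast+

lemma symbol_pos: "a \<in> alphabet A \<Longrightarrow> 0 < a"
  by (subst (asm) alphabet_eq) simp

lemma state_pos: "q \<in> states A \<Longrightarrow> 0 < q" and state_le: "q \<in> states A \<Longrightarrow> q \<le> card (states A)"
  by (subst (asm) states_eq, simp)+

lemma finite_states: "finite (states A)" and initial_state: "initial A \<in> states A"
  and final_state: "final A \<in> states A"
  using enfa by (auto simp: is_enfa_def)

lemma m_eq: "m = card (delta A)"
  using ts distinct_card by metis

lemma states_le: "card (states A) \<le> m + 1"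
  using card_states_le[of A] inst m_eq ts(2) by (metis List.finite_set matching_instance_def)

lemma src_state: "j < m \<Longrightarrow> src j \<in> states A" and tgt_state: "j < m \<Longrightarrow> tgt j \<in> states A"
  using enfa ts(2) nth_mem[of j ts] by (fastforce simp: is_enfa_def src_def tgt_def)+

lemma set_out: "set (out j q) = {i. i < j \<and> src i = q}"
  by (auto simp: out_def)

lemma out_Suc: "out (Suc j) q = (if src j = q then j # out j q else out j q)"
  by (simp add: out_def)

text \<open>Each transition is counted once, at its source. This bounds the total length of the
  lists walked at one position of the word.\<close>

lemma sum_length_out: "(\<Sum>q\<in>states A. length (out j q)) = j" if "j \<le> m"
  using that
proof (induction j)
  case (Suc j)
  have "(\<Sum>q\<in>states A. length (out (Suc j) q)) =
    (\<Sum>q\<in>states A. length (out j q) + (if src j = q then 1 else 0))"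
    by (intro sum.cong) (auto simp: out_Suc)
  then show ?case using Suc src_state[of j] finite_states by (simp add: sum.distrib)
qed (simp add: out_def)

text \<open>Division with remainder by \<open>S\<close> recovers both coordinates.\<close>

lemma cell_inj: "k < S \<Longrightarrow> k' < S \<Longrightarrow> cell q k = cell q' k' \<longleftrightarrow> q = q' \<and> k = k'"
proof -
  assume k: "k < S" "k' < S"
  have "q = q' \<and> k = k'" if "q * S + k = q' * S + k'"
  proof -
    have "(q * S + k) div S = q" "(q' * S + k') div S = q'" "(q * S + k) mod S = k"
      "(q' * S + k') mod S = k'"
      using k by auto
    then show ?thesis using that by metis
  qed
  then show ?thesis by (auto simp: cell_def)
qed

lemma cell_greater: "q \<in> states A \<Longrightarrow> L < cell q k"
  using state_pos[of q] by (auto simp: cell_def S_def)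

lemma adr_inj: "v \<in> V \<Longrightarrow> v' \<in> V \<Longrightarrow> adr v = adr v' \<longleftrightarrow> v = v'"
  by (auto simp: adr_def V_def cell_inj S_def prod_eq_iff)

lemma adr_greater: "v \<in> V \<Longrightarrow> L < adr v"
  by (auto simp: adr_def V_def cell_greater)

lemma head_not_adr: "q \<in> states A \<Longrightarrow> cell q 0 \<notin> adr ` V"
  by (auto simp: adr_def V_def cell_inj S_def)

text \<open>Since \<open>n \<le> m + 1\<close>, the bound on \<open>x\<close> is at most
  \<open>L + (m + 2) * S\<close>, which is below the square of the input length
  \<open>L\<close>.\<close>

lemma word_bound: "x \<le> L + (card (states A) + 1) * S \<Longrightarrow> x < 2 ^ b"
proof -
  assume x: "x \<le> L + (card (states A) + 1) * S"
  have "(card (states A) + 1) * S \<le> (m + 2) * S"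
    using states_le by (intro mult_right_mono) auto
  then have "x \<le> L + (m + 2) * S" using x by linarith
  also have "\<dots> < L ^ 2" by (simp add: L_def S_def power2_eq_square algebra_simps)
  also have "\<dots> \<le> 2 ^ b" using word_length by (simp add: length_encode L_def)
  finally show ?thesis .
qed

lemma cell_bound: "q \<in> states A \<Longrightarrow> k \<le> S \<Longrightarrow> cell q k < 2 ^ b"
proof (rule word_bound)
  assume "q \<in> states A" "k \<le> S"
  then have "q * S + k \<le> card (states A) * S + S"
    using state_le[of q] by (intro add_mono mult_right_mono) auto
  then show "cell q k \<le> L + (card (states A) + 1) * S" by (simp add: cell_def)
qed

lemma const_bound: "k < 36 \<Longrightarrow> k < (2::nat) ^ b"
proof -
  \<comment> \<open>The header alone makes the input at least 6 words long.\<close>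
  have "36 \<le> L ^ 2" using power_mono[of 6 L 2] by (simp add: L_def)
  also have "\<dots> \<le> 2 ^ b" using word_length by (simp add: length_encode L_def)
  finally show "k < 36 \<Longrightarrow> k < (2::nat) ^ b" by simp
qed

section \<open>Building the lists of outgoing transitions\<close>

definition "base M \<longleftrightarrow> M 2 = initial A \<and> M 3 = final A \<and>
  (\<forall>j<m. M (7 + 3 * j) = lab j \<and> M (8 + 3 * j) = tgt j) \<and>
  (\<forall>i\<le>length w. M (6 + 3 * m + i) = letter i)"

text \<open>Sources are guaranteed only from transition \<open>j\<close> on, since the earlier ones
  have been replaced by links.\<close>

definition "built j M \<longleftrightarrow> base M \<and>
  (\<forall>q\<in>states A. chain 0 M (M (cell q 0)) (map ptr (out j q))) \<and>
  (\<forall>i. j \<le> i \<and> i < m \<longrightarrow> M (ptr i) = src i) \<and>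
  (\<forall>v\<in>V. M (adr v) = 0)"

definition "fixed R \<longleftrightarrow> R 0 = 0 \<and> R 1 = 1 \<and> R 2 = L \<and> R 3 = S \<and> R 5 = 5 + 3 * m \<and>
  R 6 = flag"

lemma built_0: "built 0 (mem (initial_config (encode A ts w)))"
proof -
  let ?M = "mem (initial_config (encode A ts w))"
  have M: "?M i = (if i < L then encode A ts w ! i else 0)" for i
    by (simp add: initial_config_def length_encode L_def)
  have t: "?M (6 + 3 * j + d) = encode_transition (ts ! j) ! d" if "j < m" "d < 3" for j d
    using that nth_encode_transition[OF that, of A w] unfolding M by (simp add: L_def)
  have "?M (6 + 3 * m + i) = letter i" if "i \<le> length w" for i
    using that nth_encode_word[of i w A ts] unfolding M by (simp add: L_def letter_def)
  moreover have "?M (6 + 3 * j) = src j" "?M (7 + 3 * j) = lab j"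
    "?M (8 + 3 * j) = tgt j" if "j < m" for j
    using t[OF that, of 0] t[OF that, of 1] t[OF that, of 2]
    by (cases "ts ! j"; simp add: src_def lab_def tgt_def)+
  moreover have "?M 2 = initial A" "?M 3 = final A" unfolding M by (simp_all add: L_def nth_encode)
  moreover have "?M (adr v) = 0" if "v \<in> V" for v using adr_greater[OF that] unfolding M by simp
  moreover have "?M (cell q 0) = 0" if "q \<in> states A" for q using cell_greater[OF that, of 0]
    unfolding M by simp
  ultimately show ?thesis unfolding built_def base_def by (simp add: out_def)
qed

text \<open>Neither write hits a link of a list built so far, since these links belong to
  transitions before \<open>j\<close>. So all chains survive, and one of them gets a new
  head.\<close>

lemma built_Suc:
  assumes "built j M" "j < m"
  defines "h \<equiv> cell (src j) 0"
  shows "built (Suc j) (M(ptr j := M h, h := ptr j))"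
proof -
  let ?M = "M(ptr j := M h, h := ptr j)"
  have h: "L < h" unfolding h_def by (rule cell_greater[OF src_state[OF assms(2)]])
  have le: "x \<le> L \<Longrightarrow> x \<noteq> ptr j \<Longrightarrow> ?M x = M x" for x using h by auto
  have pj: "ptr j < L" using assms(2) by (simp add: L_def)
  have "base ?M"
  proof -
    have "?M 2 = M 2" "?M 3 = M 3" using h by (auto simp: L_def)
    moreover have "?M (7 + 3 * i) = M (7 + 3 * i)" "?M (8 + 3 * i) = M (8 + 3 * i)" if "i < m" for i
      using that by (intro le; simp add: L_def; presburger)+
    moreover have "?M (6 + 3 * m + i) = M (6 + 3 * m + i)" if "i \<le> length w" for i
      using that assms(2) by (intro le) (auto simp: L_def)
    ultimately show ?thesis using assms(1) unfolding built_def base_def by presburger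
  qed
  moreover have "chain 0 ?M (?M (cell q 0)) (map ptr (out (Suc j) q))" if q: "q \<in> states A" for q
  proof -
    have c: "chain 0 M (M (cell q 0)) (map ptr (out j q))" using assms(1) q by (simp add: built_def)
    have "chain 0 ?M e (map ptr (out j q)) = chain 0 M e (map ptr (out j q))" for e
      using assms(2) by (intro chain_cong le) (auto simp: set_out L_def)
    moreover have "cell q 0 = h \<longleftrightarrow> q = src j" using src_state[OF assms(2)]
      by (auto simp: h_def cell_inj S_def)
    moreover have "ptr j \<noteq> h" "ptr j \<noteq> cell q 0" using pj h cell_greater[OF q, of 0] by auto
    ultimately show ?thesis using c by (auto simp: out_Suc h_def)
  qed
  moreover have "?M (ptr i) = src i" if "Suc j \<le> i" "i < m" for i
    using le[of "ptr i"] assms(1) that by (simp add: built_def L_def)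
  moreover have "?M (adr v) = 0" if v: "v \<in> V" for v
    using assms(1) v adr_greater[OF v] pj head_not_adr[OF src_state[OF assms(2)]]
    by (auto simp: built_def h_def image_iff)
  ultimately show ?thesis unfolding built_def by blast
qed

lemma prologue:
  "leads b P 14 (initial_config (encode A ts w))
    (\<lambda>c. pc c = 14 \<and> fixed (reg c) \<and> reg c 7 = ptr 0 \<and> reg c 14 = 3 \<and> built 0 (mem c))"
proof (rule leads_run[where k = 14 and k' = 0, OF leads_refl])
  let ?c = "initial_config (encode A ts w)"
  have c: "pc ?c = 0" "reg ?c = (\<lambda>_. 0)" by (simp_all add: initial_config_def)
  have M: "mem ?c 4 = m" "mem ?c 5 = length w"
    by (simp_all add: initial_config_def nth_encode length_encode)
  note [simp] = const_bound mod_less eval_Add eval_Mul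
  \<comment> \<open>Keeping \<open>eval_op\<close> folded makes symbolic execution use the
    overflow-free equations instead of producing moduli.\<close>
  note [simp del] = eval_op.simps
  have [simp]: "flag < 2 ^ b" by (simp add: flag_def)
  have bounds: "L < 2 ^ b" by (rule word_bound) simp
  have S: "S < 2 ^ b" by (rule word_bound) simp
  have [simp]: "m * 3 < 2 ^ b" "m * 3 + 5 < 2 ^ b" "m * 3 + 5 + length w < 2 ^ b"
    "eval_op b Add (m * 3 + 5 + length w) (Suc 0) = L"
    "Suc (Suc (length w)) < 2 ^ b" "0 < b"
    using bounds S by (simp_all add: L_def S_def) (cases "b = 0"; simp)
  show "pc (run b P 14 ?c) = 14 \<and> fixed (reg (run b P 14 ?c)) \<and> reg (run b P 14 ?c) 7 = ptr 0 \<and>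
    reg (run b P 14 ?c) 14 = 3 \<and> built 0 (mem (run b P 14 ?c))"
    using built_0
    by (simp add: exec_simps c M fixed_def L_def S_def)
qed simp

section \<open>Depth-first search\<close>

text \<open>Nine instructions per transition and one for the exit. The exit test is
  \<open>5 + 3 * m < 6 + 3 * j\<close>, which holds exactly if \<open>m \<le> j\<close>.\<close>

lemma build_loop:
  assumes "pc c = 14" "fixed (reg c)" "reg c 7 = ptr j" "reg c 14 = 3" "built j (mem c)" "j \<le> m"
  shows "leads b P (9 * (m - j) + 1) c (\<lambda>c. pc c = 23 \<and> fixed (reg c) \<and> built m (mem c))"
  using assms
proof (induction "m - j" arbitrary: j c)
  case 0
  then have "j = m" by simp
  with 0 have "pc (run b P 1 c) = 23 \<and> fixed (reg (run b P 1 c)) \<and> built m (mem (run b P 1 c))"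
    by (simp add: exec_simps fixed_def)
  then show ?case using \<open>j = m\<close> by (intro leads_mono[OF leads_run0[where k = 1]]) simp_all
next
  case (Suc k)
  then have j: "j < m" by simp
  note [simp del] = eval_op.simps
  have b1: "cell (src j) 0 < 2 ^ b" by (rule cell_bound[OF src_state[OF j]]) simp
  then have "src j * S < 2 ^ b" "src j * S + L < 2 ^ b" "6 + 3 * j + 3 < 2 ^ b"
    using j word_bound[of "6 + 3 * j + 3"] by (simp_all add: cell_def add.commute L_def)
  from eval_Mul[OF this(1)] eval_Add[OF this(2)] eval_Add[OF this(3)]
  have [simp]: "eval_op b Mul (src j) S = src j * S" "eval_op b Add (src j * S) L = cell (src j) 0"
    "eval_op b Add (6 + 3 * j) 3 = 9 + 3 * j"
    by (simp_all add: cell_def add.commute)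
  have src: "mem c (ptr j) = src j" using Suc.prems j by (simp add: built_def)
  have ne: "cell (src j) 0 \<noteq> ptr j" using cell_greater[OF src_state[OF j], of 0] j
    by (simp add: L_def)
  define M where "M = mem c"
  let ?c = "run b P 9 c"
  have *: "pc ?c = 14" "fixed (reg ?c)" "reg ?c 7 = ptr (Suc j)" "reg ?c 14 = 3"
    "mem ?c = M(ptr j := M (cell (src j) 0), cell (src j) 0 := ptr j)"
    using Suc.prems j src ne by (simp_all add: exec_simps fixed_def M_def)
  have "built (Suc j) (mem ?c)"
    unfolding *(5) using built_Suc[OF _ j, of M] Suc.prems(5) by (simp add: M_def)
  from leads_run[OF Suc.hyps(1)[OF _ *(1-4) this]] show ?case using Suc.hyps(2) j by simp
qed

end

section \<open>The stack and the visited nodes in memory\<close>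

locale prepared = machine +
  fixes N :: "nat \<Rightarrow> nat"
  assumes N: "built m N"
begin

text \<open>\<open>N\<close> is the memory at the start of the search, which writes to cells of
  nodes only. The pointer \<open>e\<close> must differ from \<open>0\<close>, since a push writes it
  to the new cell, where \<open>0\<close> would mean not visited.\<close>

definition "store D St e M \<longleftrightarrow> (\<forall>a. a \<notin> adr ` V \<longrightarrow> M a = N a) \<and>
  (\<forall>v\<in>V. M (adr v) = 0 \<longleftrightarrow> v \<notin> D \<union> set St) \<and> chain 1 M e (map adr St) \<and> e \<noteq> 0 \<and>
  D \<subseteq> V \<and> set St \<subseteq> V \<and> distinct St \<and> D \<inter> set St = {}"

lemma push:
  assumes "store D St e M" "v \<in> V" "v \<notin> D" "v \<notin> set St"
  shows "store D (v # St) (adr v) (M(adr v := e))"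
proof -
  have "chain 1 (M(adr v := e)) e (map adr St) = chain 1 M e (map adr St)"
    using assms by (intro chain_cong) (auto simp: store_def adr_inj)
  moreover have "1 < adr v" using adr_greater[OF assms(2)] by (simp add: L_def)
  ultimately show ?thesis using assms by (auto simp: store_def adr_inj)
qed

lemma pop:
  assumes "store D (v # St) e M"
  shows "e = adr v" "store (insert v D) St (M e) M"
proof -
  show "e = adr v" using assms by (simp add: store_def)
  moreover have "v \<in> V" "M (adr v) \<noteq> 0" using assms by (auto simp: store_def)
  ultimately show "store (insert v D) St (M e) M" using assms by (auto simp: store_def)
qed

text \<open>
  \<open>X\<close> is the set of visited nodes and \<open>D\<close> the set of those that were popped. The remaining time is
  charged to the nodes outside \<open>D\<close>, so that visiting a node is free.
\<close>

definition state :: "(nat \<times> nat) set \<Rightarrow> (nat \<times> nat) set \<Rightarrow> config \<Rightarrow> bool" where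
  "state D X c \<longleftrightarrow> fixed (reg c) \<and> (\<exists>St. store D St (reg c 4) (mem c) \<and> X = D \<union> set St)"

lemma state_read: "state D X c \<Longrightarrow> a \<notin> adr ` V \<Longrightarrow> mem c a = N a"
  by (auto simp: state_def store_def)

lemma state_cong:
  assumes "state D X c" "\<And>r. r \<le> 6 \<Longrightarrow> reg c' r = reg c r" "mem c' = mem c"
  shows "state D X c'"
  using assms by (auto simp: state_def fixed_def)

definition keep :: "config \<Rightarrow> config \<Rightarrow> bool" where
  "keep c c' \<longleftrightarrow> reg c' 7 = reg c 7 \<and> reg c' 8 = reg c 8 \<and> reg c' 9 = reg c 9"

text \<open>The program contains this block, which pushes a node unless it has been visited, at
  three places; hence the arbitrary position \<open>p\<close>.\<close>

lemma visit:
  assumes c: "pc c = p" "state D X c" "reg c 10 = adr v" "v \<in> V"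
    and P: "P ! p = Load 11 10" "P ! (p + 1) = JumpLess 0 11 (p + 4)" "P ! (p + 2) = Store 10 4"
      "P ! (p + 3) = Op Add 4 10 0" "p + 4 < 79"
  shows "leads b P 4 c (\<lambda>c'. pc c' = p + 4 \<and> state D (insert v X) c' \<and>
    keep c c' \<and> reg c' 10 = reg c 10 \<and> reg c' 12 = reg c 12)"
    (is "leads b P 4 c ?Q")
proof -
  obtain St where St: "store D St (reg c 4) (mem c)" "X = D \<union> set St" and f: "fixed (reg c)"
    using c(2) by (auto simp: state_def)
  have v: "mem c (adr v) = 0 \<longleftrightarrow> v \<notin> X" using St c(4) by (auto simp: store_def)
  have p: "p + 1 = Suc p" "p + 2 = Suc (Suc p)" "p + 3 = Suc (Suc (Suc p))"
    "p + 4 = Suc (Suc (Suc (Suc p)))"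
    by simp_all
  note [simp] = P[unfolded p]
  have [simp]: "p < 79" "p < 78" "p < 77" "p < 76" using P(5) by simp_all
  show ?thesis
  proof (cases "v \<in> X")
    case True
    have "pc (run b P 2 c) = p + 4" "mem (run b P 2 c) = mem c"
      and r: "reg (run b P 2 c) = (reg c)(11 := mem c (adr v))"
      unfolding p using v True c f by (simp_all add: run_numeral step_eq length_prog fixed_def)
    moreover from this have "state D (insert v X) (run b P 2 c)"
      using state_cong[OF c(2), of "run b P 2 c"] insert_absorb[OF True] by simp
    ultimately have "?Q (run b P 2 c)" by (simp add: keep_def)
    then show ?thesis by (intro leads_mono[OF leads_run0[where k = 2]]) simp_all
  next
    case False
    have "adr v < 2 ^ b" using c(4) by (auto simp: adr_def V_def S_def intro!: cell_bound)
    then have r: "pc (run b P 4 c) = p + 4" "mem (run b P 4 c) = (mem c)(adr v := reg c 4)"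
      "reg (run b P 4 c) = (reg c)(11 := 0, 4 := adr v)"
      unfolding p using v False c f
      by (simp_all add: run_numeral step_eq length_prog fixed_def)
    have "store D (v # St) (adr v) ((mem c)(adr v := reg c 4))"
      using push[OF St(1) c(4)] False St(2) by simp
    then have "state D (insert v X) (run b P 4 c)"
      unfolding state_def r using St(2) f by (auto simp: fixed_def intro!: exI[of _ "v # St"])
    then have "?Q (run b P 4 c)" using r by (simp add: keep_def)
    then show ?thesis by (rule leads_run0)
  qed
qed

section \<open>Edges leaving a popped node, as the machine finds them\<close>

definition stay_succ where
  "stay_succ j i = (if super \<or> lab j = 0 then {(tgt j, i)} else {})"

text \<open>The condition \<open>lab j \<noteq> 0\<close> keeps an empty label from matching the
  \<open>0\<close> that is read behind the last letter.\<close>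

definition read_succ where
  "read_succ j i = (if lab j \<noteq> 0 \<and>
  lab j = letter i then {(tgt j, Suc i)} else {})"

definition skip_succ where
  "skip_succ q i = (if \<not> super \<and> letter i \<noteq> 0 then {(q, Suc i)} else {})"

lemma letter_length: "letter i \<noteq> 0 \<Longrightarrow> Suc i \<le> length w"
  by (auto simp: letter_def split: if_splits)

text \<open>Symbols are positive, so a letter \<open>0\<close> tells the machine that the word has
  ended.\<close>

lemma letter_0_iff: "letter i = 0 \<longleftrightarrow> length w \<le> i"
  using symbol_pos[OF subsetD[OF word nth_mem[of i w]]] by (auto simp: letter_def)

lemma low_not_adr: "a \<le> L \<Longrightarrow> a \<notin> adr ` V"
  using adr_greater by fastforce

lemma edge_fetch:
  assumes "pc c = 45" "state D X c" "reg c 7 = ptr j" "reg c 8 = Suc i" "j < m" "i \<le> length w"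
  shows "leads b P 8 c (\<lambda>c'. pc c' = 53 \<and> state D X c' \<and> keep c c' \<and> reg c' 12 = lab j \<and>
    reg c' 10 = adr (tgt j, i))"
proof (rule leads_run0)
  note [simp del] = eval_op.simps
  have t: "tgt j \<in> states A" by (rule tgt_state[OF assms(5)])
  have "cell (tgt j) (Suc i) < 2 ^ b" using assms t by (intro cell_bound) (auto simp: S_def)
  then have "tgt j * S < 2 ^ b" "tgt j * S + L < 2 ^ b" "tgt j * S + L + Suc i < 2 ^ b"
    "6 + 3 * j + 1 < 2 ^ b" "7 + 3 * j + 1 < 2 ^ b"
    using assms(5) word_bound[of "8 + 3 * j"] by (simp_all add: L_def cell_def)
  from eval_Mul[OF this(1)] this(2-)[THEN eval_Add]
  have [simp]: "eval_op b Mul (tgt j) S = tgt j * S" "eval_op b Add (tgt j * S) L = cell (tgt j) 0"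
    "eval_op b Add (cell (tgt j) 0) (Suc i) = adr (tgt j, i)"
    "eval_op b Add (6 + 3 * j) (Suc 0) = 7 + 3 * j" "eval_op b Add (7 + 3 * j) (Suc 0) = 8 + 3 * j"
    by (simp_all add: cell_def adr_def ac_simps)
  have "mem c (7 + 3 * j) = N (7 + 3 * j)" "mem c (8 + 3 * j) = N (8 + 3 * j)"
    using assms(5) by (intro state_read[OF assms(2)] low_not_adr; simp add: L_def)+
  then have M: "mem c (7 + 3 * j) = lab j" "mem c (8 + 3 * j) = tgt j"
    using N assms(5) by (simp_all add: built_def base_def)
  have f: "fixed (reg c)" using assms(2) by (simp add: state_def)
  let ?c = "run b P 8 c"
  have "mem ?c = mem c" "\<And>r. r \<le> 6 \<Longrightarrow> reg ?c r = reg c r"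
    "pc ?c = 53 \<and> keep c ?c \<and> reg ?c 12 = lab j \<and> reg ?c 10 = adr (tgt j, i)"
    using assms f M by (simp_all add: exec_simps fixed_def keep_def)
  then show "pc ?c = 53 \<and> state D X ?c \<and> keep c ?c \<and> reg ?c 12 = lab j \<and> reg ?c 10 = adr (tgt j, i)"
    using state_cong[OF assms(2), of ?c] by simp
qed

lemma edge_stay:
  assumes "pc c = 53" "state D X c" "reg c 12 = lab j" "reg c 10 = adr (tgt j, i)" "j < m"
    "i \<le> length w"
  shows "leads b P 6 c (\<lambda>c'. pc c' = 59 \<and> state D (X \<union> stay_succ j i) c' \<and> keep c c' \<and>
    reg c' 10 = reg c 10 \<and> reg c' 12 = reg c 12)"
    (is "leads b P 6 c ?Q")
proof -
  have f: "fixed (reg c)" using assms(2) by (simp add: state_def)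
  show ?thesis
  proof (cases "super \<or> lab j = 0")
    case True
    then have e: "stay_succ j i = {(tgt j, i)}" unfolding stay_succ_def by simp
    \<comment> \<open>One jump suffices for supersequences; otherwise the label is tested as
      well.\<close>
    define k where "k = (if super then 1 else 2 :: nat)"
    let ?c = "run b P k c"
    have c: "pc ?c = 55" "reg ?c = reg c" "mem ?c = mem c"
      using assms True f[unfolded fixed_def flag_def] by (auto simp: exec_simps k_def)
    have "state D X ?c" using state_cong[OF assms(2), of ?c] c by simp
    then have "leads b P 4 ?c (\<lambda>c'. pc c' = 55 + 4 \<and> state D (insert (tgt j, i) X) c' \<and>
      keep ?c c' \<and> reg c' 10 = reg ?c 10 \<and> reg c' 12 = reg ?c 12)"
      using assms c tgt_state[of j] by (intro visit) (auto simp: prog_nth V_def)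
    then have "leads b P 4 ?c ?Q"
      by (rule leads_mono) (use e c in \<open>auto simp: keep_def\<close>)
    then show ?thesis unfolding k_def by (rule leads_run) simp
  next
    case False
    then have e: "stay_succ j i = {}" unfolding stay_succ_def by simp
    let ?c = "run b P 2 c"
    have c: "pc ?c = 59" "reg ?c = reg c" "mem ?c = mem c"
      using assms False f[unfolded fixed_def flag_def] by (auto simp: exec_simps)
    then have "?Q ?c" using state_cong[OF assms(2), of ?c] e by (simp add: keep_def)
    then show ?thesis by (intro leads_mono[OF leads_run0[where k = 2]]) simp_all
  qed
qed

lemma edge_read:
  assumes "pc c = 59" "state D X c" "reg c 12 = lab j" "reg c 10 = adr (tgt j, i)" "j < m"
    "i \<le> length w"
    and "reg c 9 = letter i"
  shows "leads b P 8 c (\<lambda>c'. pc c' = 67 \<and> state D (X \<union> read_succ j i) c' \<and> keep c c')"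
    (is "leads b P 8 c ?Q")
proof -
  have f: "fixed (reg c)" using assms(2) by (simp add: state_def)
  show ?thesis
  proof (cases "lab j \<noteq> 0 \<and> lab j = letter i")
    case True
    then have i: "Suc i \<le> length w" using letter_length by simp
    have v: "(tgt j, Suc i) \<in> V" using i tgt_state[of j] assms(5) by (simp add: V_def)
    have "adr (tgt j, Suc i) < 2 ^ b"
      using i tgt_state[of j] assms(5) by (auto simp: adr_def S_def intro!: cell_bound)
    \<comment> \<open>Consecutive positions of one state lie in adjacent cells.\<close>
    then have eq: "eval_op b Add (adr (tgt j, i)) (Suc 0) = adr (tgt j, Suc i)"
      by (subst eval_Add) (simp_all add: adr_def cell_def)
    note [simp del] = eval_op.simps
    let ?c = "run b P 3 c"
    have c: "pc ?c = 63" "reg ?c = (reg c)(10 := adr (tgt j, Suc i))" "mem ?c = mem c"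
      using assms True f[unfolded fixed_def flag_def] eq by (auto simp: exec_simps fixed_def)
    have "state D X ?c" using state_cong[OF assms(2), of ?c] c by simp
    then have "leads b P 4 ?c (\<lambda>c'. pc c' = 63 + 4 \<and> state D (insert (tgt j, Suc i) X) c' \<and>
      keep ?c c' \<and> reg c' 10 = reg ?c 10 \<and> reg c' 12 = reg ?c 12)"
      using c v by (intro visit) (auto simp: prog_nth)
    then have "leads b P 4 ?c ?Q"
      by (rule leads_mono) (use True c in \<open>auto simp: read_succ_def keep_def\<close>)
    then show ?thesis by (rule leads_run) simp
  next
    case False
    define k where "k = (if lab j = 0 then 1 else 3 :: nat)"
    let ?c = "run b P k c"
    have c: "pc ?c = 67" "reg ?c = reg c" "mem ?c = mem c"
      using assms False f[unfolded fixed_def flag_def] by (auto simp: exec_simps fixed_def k_def)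
    then have "?Q ?c" using state_cong[OF assms(2), of ?c] False
      by (auto simp: read_succ_def keep_def)
    then show ?thesis by (intro leads_mono[OF leads_run0[where k = k]]) (simp_all add: k_def)
  qed
qed

lemma edge_advance:
  assumes "pc c = 67" "state D X c" "reg c 7 = ptr j" "j < m"
  shows "leads b P 2 c (\<lambda>c'. pc c' = 45 \<and> state D X c' \<and> reg c' 7 = N (ptr j) \<and> reg c' 8 = reg c 8 \<and>
    reg c' 9 = reg c 9)"
proof (rule leads_run0)
  let ?c = "run b P 2 c"
  have "mem c (6 + 3 * j) = N (6 + 3 * j)"
    using assms(4) by (intro state_read[OF assms(2)] low_not_adr) (simp add: L_def)
  then have "pc ?c = 45" "reg ?c = (reg c)(7 := N (ptr j))" "mem ?c = mem c"
    using assms by (simp_all add: exec_simps)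
  then show "pc ?c = 45 \<and> state D X ?c \<and> reg ?c 7 = N (ptr j) \<and> reg ?c 8 = reg c 8 \<and>
    reg ?c 9 = reg c 9"
    using state_cong[OF assms(2), of ?c] by simp
qed

text \<open>The bound is \<open>8 + 6 + 8 + 2\<close>, for fetching, staying, reading and advancing
  to the next transition.\<close>

lemma edge_step:
  assumes "pc c = 45" "state D X c" "reg c 7 = ptr j" "reg c 8 = Suc i" "reg c 9 = letter i"
    "j < m" "i \<le> length w"
  shows "leads b P 24 c (\<lambda>c'. pc c' = 45 \<and> state D (X \<union> (stay_succ j i \<union> read_succ j i)) c' \<and>
    reg c' 7 = N (ptr j) \<and> reg c' 8 = Suc i \<and> reg c' 9 = letter i)"
proof (rule leads_trans[OF edge_fetch])
  fix c1 :: config assume 1: "pc c1 = 53 \<and> state D X c1 \<and> keep c c1 \<and> reg c1 12 = lab j \<and>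
    reg c1 10 = adr (tgt j, i)"
  show "leads b P 16 c1 (\<lambda>c'. pc c' = 45 \<and> state D (X \<union> (stay_succ j i \<union> read_succ j i)) c' \<and>
    reg c' 7 = N (ptr j) \<and> reg c' 8 = Suc i \<and> reg c' 9 = letter i)"
  proof (rule leads_trans[OF edge_stay[of c1 D X j i]])
    fix c2 :: config assume 2: "pc c2 = 59 \<and> state D (X \<union> stay_succ j i) c2 \<and> keep c1 c2 \<and>
      reg c2 10 = reg c1 10 \<and> reg c2 12 = reg c1 12"
    show "leads b P 10 c2 (\<lambda>c'. pc c' = 45 \<and> state D (X \<union> (stay_succ j i \<union> read_succ j i)) c' \<and>
      reg c' 7 = N (ptr j) \<and> reg c' 8 = Suc i \<and> reg c' 9 = letter i)"
    proof (rule leads_trans[OF edge_read[of c2 D "X \<union> stay_succ j i" j i]])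
      fix c3 :: config assume 3: "pc c3 = 67 \<and> state D (X \<union> stay_succ j i \<union> read_succ j i) c3 \<and>
        keep c2 c3"
      show "leads b P 2 c3 (\<lambda>c'. pc c' = 45 \<and> state D (X \<union> (stay_succ j i \<union> read_succ j i)) c' \<and>
        reg c' 7 = N (ptr j) \<and> reg c' 8 = Suc i \<and> reg c' 9 = letter i)"
        by (rule leads_mono[OF edge_advance[of c3 D "X \<union> stay_succ j i \<union> read_succ j i" j]])
          (use assms 1 2 3 in \<open>auto simp: keep_def Un_assoc\<close>)
    qed (use assms 1 2 in \<open>auto simp: keep_def\<close>)
  qed (use assms 1 in auto)
qed (use assms in auto)

text \<open>The list is followed in \<open>N\<close>, as the search leaves the links between
  transitions intact. The additional step is the jump at the end marker.\<close>

lemma edge_loop: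
  assumes "pc c = 45" "state D X c" "chain 0 N (reg c 7) (map ptr js)" "reg c 8 = Suc i"
    "reg c 9 = letter i"
    "set js \<subseteq> {..<m}" "i \<le> length w"
  shows "leads b P (24 * length js + 1) c
    (\<lambda>c'. pc c' = 30 \<and> state D (X \<union> (\<Union>j\<in>set js. stay_succ j i \<union> read_succ j i)) c')"
  using assms
proof (induction js arbitrary: c X)
  case Nil
  let ?c = "run b P 1 c"
  have "fixed (reg c)" using Nil by (simp add: state_def)
  then have "pc ?c = 30" "reg ?c = reg c" "mem ?c = mem c"
    using Nil by (simp_all add: exec_simps fixed_def)
  then show ?case using state_cong[OF Nil(2), of ?c]
    by (intro leads_mono[OF leads_run0[where k = 1]]) simp_all
next
  case (Cons j js)
  show ?case
  proof (rule leads_trans[OF edge_step[of c D X j i]])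
    fix c' :: config assume c': "pc c' = 45 \<and> state D (X \<union> (stay_succ j i \<union> read_succ j i)) c' \<and>
      reg c' 7 = N (ptr j) \<and> reg c' 8 = Suc i \<and> reg c' 9 = letter i"
    then show "leads b P (24 * length js + 1) c'
      (\<lambda>c'. pc c' = 30 \<and> state D (X \<union> (\<Union>j\<in>set (j # js). stay_succ j i \<union> read_succ j i)) c')"
      using Cons.IH[of c' "X \<union> (stay_succ j i \<union> read_succ j i)"] Cons.prems by (simp add: Un_assoc)
  qed (use Cons.prems in auto)
qed

text \<open>The address of \<open>(q, i)\<close> exceeds \<open>L\<close> by
  \<open>q * S + i + 1\<close>. As \<open>i + 1 < S\<close>, the remainder modulo \<open>S\<close>
  is \<open>i + 1\<close>, and subtracting it from the address leads to the head cell of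
  \<open>q\<close>.\<close>

lemma pop_fetch:
  assumes "pc c = 30" "state D X c" "X \<noteq> D"
  shows "\<exists>q i. (q, i) \<in> X - D \<and> (q, i) \<in> V \<and> leads b P 9 c (\<lambda>c'. pc c' = 39 \<and>
    state (insert (q, i) D) X c' \<and>
    reg c' 7 = N (cell q 0) \<and> reg c' 8 = Suc i \<and> reg c' 9 = letter i \<and>
      reg c' 10 = Suc (adr (q, i)))"
proof -
  have f: "fixed (reg c)" using assms(2) by (simp add: state_def)
  obtain v St where St: "store D (v # St) (reg c 4) (mem c)" "X = D \<union> set (v # St)"
    using assms unfolding state_def by (metis Un_empty_right list.set(1) neq_Nil_conv)
  obtain q i where v: "v = (q, i)" by (cases v)
  have V: "(q, i) \<in> V" and D: "(q, i) \<notin> D" using St v by (auto simp: store_def)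
  then have q: "q \<in> states A" and i: "i \<le> length w" by (auto simp: V_def)
  have r4: "reg c 4 = adr (q, i)" using pop(1)[OF St(1)] v by simp
  \<comment> \<open>The bottom marker is no address of a node, so the jump out of the search loop is
    not taken.\<close>
  have ne: "adr (q, i) \<noteq> Suc 0" using adr_greater[OF V] by (simp add: L_def)
  have b1: "Suc (adr (q, i)) < 2 ^ b"
    using cell_bound[OF q, of "Suc (Suc i)"] i by (simp add: S_def adr_def cell_def)
  have b2: "5 + 3 * m + Suc i < 2 ^ b" using i by (intro word_bound) (simp add: L_def)
  have eq [simp]: "eval_op b Sub (adr (q, i)) L = q * S + Suc i"
      "eval_op b Mod (Suc (q * S + i)) S = Suc i"
      "eval_op b Sub (adr (q, i)) (Suc i) = cell q 0"
      "eval_op b Add (5 + 3 * m) (Suc i) = 6 + 3 * m + i"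
      "eval_op b Add (adr (q, i)) (Suc 0) = Suc (adr (q, i))"
  proof -
    have a: "adr (q, i) = L + (q * S + Suc i)" "adr (q, i) = cell q 0 + Suc i"
      by (simp_all add: adr_def cell_def)
    show "eval_op b Sub (adr (q, i)) L = q * S + Suc i"
      using b1 a(1) by (subst eval_Sub) simp_all
    show "eval_op b Sub (adr (q, i)) (Suc i) = cell q 0"
      using b1 a(2) by (subst eval_Sub) simp_all
    have "Suc i < S" using i by (simp add: S_def)
    then have "(q * S + Suc i) mod S = Suc i" by (metis mod_less mod_mult_self3)
    then show "eval_op b Mod (Suc (q * S + i)) S = Suc i"
      using b1 a(1) by (subst eval_Mod) simp_all
    show "eval_op b Add (5 + 3 * m) (Suc i) = 6 + 3 * m + i"
      using b2 by (subst eval_Add) simp_all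
    show "eval_op b Add (adr (q, i)) (Suc 0) = Suc (adr (q, i))"
      using b1 by (subst eval_Add) simp_all
  qed
  note [simp del] = eval_op.simps
  have mem: "mem c (cell q 0) = N (cell q 0)" by (intro state_read[OF assms(2)] head_not_adr q)
  have "mem c (6 + 3 * m + i) = N (6 + 3 * m + i)"
    using i by (intro state_read[OF assms(2)] low_not_adr) (simp add: L_def)
  then have l: "mem c (6 + 3 * m + i) = letter i" using N i by (simp add: built_def base_def)
  let ?c = "run b P 9 c"
  have c: "pc ?c = 39 \<and> reg ?c 7 = N (cell q 0) \<and> reg ?c 8 = Suc i \<and> reg ?c 9 = letter i \<and>
    reg ?c 10 = Suc (adr (q, i))"
      "mem ?c = mem c" "reg ?c 4 = mem c (adr (q, i))" "fixed (reg ?c)"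
    using assms f r4 ne mem l by (simp_all add: exec_simps fixed_def)
  have "store (insert (q, i) D) St (reg ?c 4) (mem ?c)"
    using pop[OF St(1)] c v by simp
  then have "state (insert (q, i) D) X ?c" using c(4) St(2) v unfolding state_def by auto
  then show ?thesis using c(1) V D St(2) v by (intro exI[of _ q] exI[of _ i] conjI leads_run0) auto
qed

lemma pop_skip:
  assumes "pc c = 39" "state D X c" "reg c 10 = Suc (adr (q, i))" "reg c 9 = letter i"
    "q \<in> states A"
  shows "leads b P 6 c (\<lambda>c'. pc c' = 45 \<and> state D (X \<union> skip_succ q i) c' \<and> keep c c')"
    (is "leads b P 6 c ?Q")
proof -
  have f: "fixed (reg c)" using assms(2) by (simp add: state_def)
  show ?thesis
  proof (cases "\<not> super \<and> letter i \<noteq> 0")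
    case True
    then have e: "skip_succ q i = {(q, Suc i)}" unfolding skip_succ_def by simp
    from True have v: "(q, Suc i) \<in> V" using letter_length[of i] assms(5) by (simp add: V_def)
    let ?c = "run b P 2 c"
    have c: "pc ?c = 41" "reg ?c = reg c" "mem ?c = mem c"
      using assms True f[unfolded fixed_def flag_def] by (auto simp: exec_simps)
    have "state D X ?c" using state_cong[OF assms(2), of ?c] c by simp
    then have "leads b P 4 ?c (\<lambda>c'. pc c' = 41 + 4 \<and> state D (insert (q, Suc i) X) c' \<and>
      keep ?c c' \<and> reg c' 10 = reg ?c 10 \<and> reg c' 12 = reg ?c 12)"
      using c v assms(3) by (intro visit) (auto simp: prog_nth adr_def cell_def)
    then have "leads b P 4 ?c ?Q"
      by (rule leads_mono) (use e c in \<open>auto simp: keep_def\<close>)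
    then show ?thesis by (rule leads_run) simp
  next
    case False
    then have e: "skip_succ q i = {}" unfolding skip_succ_def by auto
    define k where "k = (if super then 1 else 2 :: nat)"
    let ?c = "run b P k c"
    have c: "pc ?c = 45" "reg ?c = reg c" "mem ?c = mem c"
      using assms False f[unfolded fixed_def flag_def] by (auto simp: exec_simps k_def)
    then have "?Q ?c" using state_cong[OF assms(2), of ?c] e by (simp add: keep_def)
    then show ?thesis by (intro leads_mono[OF leads_run0[where k = k]]) (simp_all add: k_def)
  qed
qed

section \<open>Agreement with the product graph\<close>

lemma product_image:
  assumes "(q, i) \<in> V"
  shows "product super A w `` {(q, i)} =
    skip_succ q i \<union> (\<Union>j\<in>set (out m q). stay_succ j i \<union> read_succ j i)" (is "_ = ?R")
proof -
  have q: "q \<in> states A" and i: "i \<le> length w" using assms by (auto simp: V_def)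
  have lab0: "lab j = 0 \<longleftrightarrow> fst (snd (ts ! j)) = None"
    and labS: "lab j = Suc a \<longleftrightarrow> fst (snd (ts ! j)) = Some (Suc a)" if "j < m" for j a
  proof -
    \<comment> \<open>Symbols are positive, so \<open>0\<close> encodes the empty label only and
      \<open>lab j\<close> determines the label.\<close>
    have "fst (snd (ts ! j)) \<noteq> Some 0"
      using enfa ts(2) nth_mem[OF that] symbol_pos[of 0] by (fastforce simp: is_enfa_def)
    then show "lab j = 0 \<longleftrightarrow> fst (snd (ts ! j)) = None" "lab j = Suc a \<longleftrightarrow>
      fst (snd (ts ! j)) = Some (Suc a)"
      by (auto simp: lab_def split: option.splits)
  qed
  have idx: "(q, l, r) \<in> delta A \<longleftrightarrow> (\<exists>j\<in>set (out m q). fst (snd (ts ! j)) = l \<and> tgt j = r)" for l r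
  proof -
    have "(q, l, r) \<in> delta A \<longleftrightarrow> (\<exists>j<m. ts ! j = (q, l, r))"
      using ts(2) by (metis in_set_conv_nth)
    then show ?thesis by (auto simp: set_out src_def tgt_def prod_eq_iff)
  qed
  have "(r, k) \<in> product super A w `` {(q, i)} \<longleftrightarrow> (r, k) \<in> ?R" for r k
  proof -
    have "(r, k) \<in> product super A w `` {(q, i)} \<longleftrightarrow>
      (k = i \<and> (\<exists>l. (q, l, r) \<in> delta A \<and> (super \<or> l = None))) \<or>
      (k = Suc i \<and> i < length w \<and> (q, Some (w ! i), r) \<in> delta A) \<or>
      (k = Suc i \<and> i < length w \<and> r = q \<and> \<not> super)"
      using q i by (auto simp: product.simps)
    moreover have "(r, k) \<in> skip_succ q i \<longleftrightarrow> k = Suc i \<and> i < length w \<and> r = q \<and> \<not> super"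
      using letter_0_iff[of i] by (auto simp: skip_succ_def)
    moreover have "(\<exists>j\<in>set (out m q). (r, k) \<in> stay_succ j i) \<longleftrightarrow>
      k = i \<and> (\<exists>l. (q, l, r) \<in> delta A \<and> (super \<or> l = None))"
      unfolding idx using lab0 by (auto simp: stay_succ_def set_out)
    moreover have "(r, k) \<in> read_succ j i \<longleftrightarrow> k = Suc i \<and> i < length w \<and> tgt j = r \<and>
      fst (snd (ts ! j)) = Some (w ! i)"
      if "j < m" for j
    proof (cases "lab j")
      case 0
      then show ?thesis using lab0[OF that] by (simp add: read_succ_def)
    next
      case (Suc a)
      then show ?thesis using labS[OF that, of a] letter_0_iff[of i]
        by (auto simp: read_succ_def letter_def)
    qed
    then have "(\<exists>j\<in>set (out m q). (r, k) \<in> read_succ j i) \<longleftrightarrow>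
      k = Suc i \<and> i < length w \<and> (q, Some (w ! i), r) \<in> delta A"
      unfolding idx by (auto simp: set_out)
    ultimately show ?thesis by blast
  qed
  then show ?thesis by (intro set_eqI) (auto simp del: Image_singleton_iff)
qed

section \<open>The search loop and its cost\<close>

lemma finite_V: "finite V"
  by (simp add: V_def finite_states)

text \<open>The stack is disjoint from the popped nodes, so it is empty if these are all the visited
  ones.\<close>

lemma state_full:
  assumes "state D D c"
  shows "reg c 4 = 1"
proof -
  obtain St where St: "store D St (reg c 4) (mem c)" and D: "D = D \<union> set St"
    using assms unfolding state_def by (elim conjE exE)
  from D have "set St \<subseteq> D" by (rule ssubst) (rule Un_upper2)
  with St have "set St = {}" unfolding store_def by (elim conjE) (simp only: Int_absorb1)
  then show ?thesis using St by (simp add: store_def)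
qed

text \<open>Invariant: visited nodes are reachable from \<open>v\<close>, and successors of popped
  nodes are visited. Once \<open>X = D\<close>, this set contains \<open>v\<close> and is closed
  under edges, hence consists of all reachable nodes. Each pop shrinks \<open>V - D\<close> and is
  paid for by the summand of the popped node.\<close>

lemma main_loop:
  assumes "pc c = 30" "state D X c"
    and "v \<in> X" "X \<subseteq> (product super A w)\<^sup>* `` {v}" "product super A w `` D \<subseteq> X"
  shows "leads b P ((\<Sum>v\<in>V - D. 16 + 24 * length (out m (fst v))) + 1) c
    (\<lambda>c'. pc c' = 69 \<and> (let R = (product super A w)\<^sup>* `` {v} in state R R c'))"
  using assms
proof (induction "card (V - D)" arbitrary: c D X rule: less_induct)
  case less
  let ?E = "product super A w"
  show ?case
  proof (cases "X = D")
    case True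
    have "?E\<^sup>* `` D = D" using less.prems(5) True by (intro Image_closed_trancl) simp
    then have "?E\<^sup>* `` {v} \<subseteq> D" using less.prems(3) True by blast
    then have X: "?E\<^sup>* `` {v} = D" "X = D" using less.prems(4) True by auto
    have f: "fixed (reg c)" using less.prems(2) by (simp add: state_def)
    have "reg c 4 = 1" using state_full less.prems(2) True by simp
    let ?c = "run b P 1 c"
    have "pc ?c = 69" "reg ?c = reg c" "mem ?c = mem c"
      using less.prems(1) f \<open>reg c 4 = 1\<close> by (simp_all add: exec_simps fixed_def)
    then show ?thesis using X state_cong[OF less.prems(2), of ?c]
      by (intro leads_mono[OF leads_run0[where k = 1]]) simp_all
  next
    case False
    obtain q i where v: "(q, i) \<in> X - D" "(q, i) \<in> V"
      and l: "leads b P 9 c (\<lambda>c'. pc c' = 39 \<and> state (insert (q, i) D) X c' \<and>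
        reg c' 7 = N (cell q 0) \<and> reg c' 8 = Suc i \<and> reg c' 9 = letter i \<and>
          reg c' 10 = Suc (adr (q, i)))"
      using pop_fetch[OF less.prems(1,2) False] by blast
    have q: "q \<in> states A" "i \<le> length w" using v by (auto simp: V_def)
    let ?D = "insert (q, i) D"
      and ?X = "X \<union> skip_succ q i \<union> (\<Union>j\<in>set (out m q). stay_succ j i \<union> read_succ j i)"
    have X: "?X = X \<union> ?E `` {(q, i)}" using product_image[OF v(2)] by (simp add: Un_assoc)
    have sub: "V - D = insert (q, i) (V - ?D)" using v by auto
    \<comment> \<open>The \<open>16\<close> is \<open>9 + 6 + 1\<close>: popping, skipping a letter,
      and leaving the loop over the transitions.\<close>
    have s: "(\<Sum>v\<in>V - D. 16 + 24 * length (out m (fst v))) =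
      16 + 24 * length (out m q) + (\<Sum>v\<in>V - ?D. 16 + 24 * length (out m (fst v)))"
      unfolding sub using finite_V by (subst sum.insert) auto
    have card: "card (V - ?D) < card (V - D)" using v finite_V by (intro psubset_card_mono) auto
    let ?Q = "\<lambda>c'. pc c' = 69 \<and> (let R = ?E\<^sup>* `` {v} in state R R c')"
    let ?k = "\<Sum>v\<in>V - ?D. 16 + 24 * length (out m (fst v))"
    show ?thesis unfolding s
    proof (rule leads_trans[OF l])
      fix c1 :: config assume 1: "pc c1 = 39 \<and> state ?D X c1 \<and> reg c1 7 = N (cell q 0) \<and>
        reg c1 8 = Suc i \<and>
        reg c1 9 = letter i \<and> reg c1 10 = Suc (adr (q, i))"
      show "leads b P (6 + 24 * length (out m q) + 1 + ?k + 1) c1 ?Q"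
      proof (rule leads_trans[OF pop_skip[of c1 ?D X q i]])
        fix c2 :: config assume 2: "pc c2 = 45 \<and> state ?D (X \<union> skip_succ q i) c2 \<and> keep c1 c2"
        have "leads b P (24 * length (out m q) + 1) c2 (\<lambda>c'. pc c' = 30 \<and> state ?D ?X c')"
          using 1 2 q N by (intro edge_loop) (auto simp: keep_def built_def set_out)
        then show "leads b P (24 * length (out m q) + 1 + ?k + 1) c2 ?Q"
        proof (rule leads_trans)
          fix c3 :: config assume 3: "pc c3 = 30 \<and> state ?D ?X c3"
          have "?E `` {(q, i)} \<subseteq> ?E\<^sup>* `` {v}"
            using v less.prems(4) by (auto intro: rtrancl_into_rtrancl)
          moreover have "state ?D (X \<union> ?E `` {(q, i)}) c3" using 3 unfolding X by blast
          ultimately show "leads b P (?k + 1) c3 ?Q"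
            using 3 less.prems(3-5) by (intro less.hyps[OF card, of c3 "X \<union> ?E `` {(q, i)}"]) auto
        qed simp
      qed (use 1 q in auto)
    qed simp
  qed
qed

text \<open>Since \<open>S = length w + 2\<close>, adding \<open>S\<close> and subtracting
  \<open>1\<close> gives the offset \<open>length w + 1\<close> of the last position.\<close>

lemma epilogue:
  assumes "pc c = 69" "state D D c"
  shows "leads b P 9 c (\<lambda>c'. pc c' = 78 \<and> reg c' 0 = (if (final A, length w) \<in> D then 1 else 0))"
proof (rule leads_run0)
  have f: "fixed (reg c)" using assms(2) by (simp add: state_def)
  let ?q = "final A"
  have V: "(?q, length w) \<in> V" using final_state by (simp add: V_def)
  have m3: "mem c 3 = ?q"
    using state_read[OF assms(2) low_not_adr, of 3] N by (simp add: L_def built_def base_def)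
  have a: "mem c (adr (?q, length w)) = 0 \<longleftrightarrow> (?q, length w) \<notin> D"
    using assms(2) V by (auto simp: state_def store_def)
  \<comment> \<open>The intermediate sum lies one cell beyond the node and must not overflow
    either.\<close>
  have b1: "cell ?q S < 2 ^ b" by (rule cell_bound[OF final_state]) simp
  have c1: "cell ?q S = L + ?q * S + S" "cell ?q S = adr (?q, length w) + 1"
    by (simp_all add: cell_def adr_def S_def)
  have [simp]: "eval_op b Mul ?q S = ?q * S" using b1 c1 by (subst eval_Mul) simp_all
  have [simp]: "eval_op b Add (?q * S) L = L + ?q * S" using b1 c1 by (subst eval_Add) simp_all
  have [simp]: "eval_op b Add (L + ?q * S) S = cell ?q S" using b1 c1 by (subst eval_Add) simp_all
  have [simp]: "eval_op b Sub (cell ?q S) (Suc 0) = adr (?q, length w)"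
    using b1 c1(2) by (subst eval_Sub) simp_all
  note [simp del] = eval_op.simps
  have [simp]: "3 mod 2 ^ b = (3::nat)" "0 < b"
    using const_bound[of 3] by (simp, cases "b = 0", simp_all)
  show "pc (run b P 9 c) = 78 \<and> reg (run b P 9 c) 0 = (if (?q, length w) \<in> D then 1 else 0)"
    using assms f m3 a
    by (cases "(?q, length w) \<in> D") (simp_all add: exec_simps fixed_def halted_def)
qed

lemma push_root:
  assumes "pc c = 23" "fixed (reg c)" "mem c = N"
  shows "leads b P 7 c (\<lambda>c'. pc c' = 30 \<and> state {} {(initial A, 0)} c')"
proof (rule leads_run0)
  let ?q = "initial A"
  have V: "(?q, 0) \<in> V" using initial_state by (simp add: V_def)
  have N2: "N 2 = ?q" using N by (simp add: built_def base_def)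
  have b1: "cell ?q 1 < 2 ^ b" by (rule cell_bound[OF initial_state]) (simp add: S_def)
  have c1: "cell ?q 1 = Suc (L + ?q * S)" "cell ?q 1 = adr (?q, 0)"
    by (simp_all add: cell_def adr_def)
  have [simp]: "eval_op b Mul ?q S = ?q * S" using b1 c1 by (subst eval_Mul) simp_all
  have [simp]: "eval_op b Add (?q * S) L = L + ?q * S" using b1 c1 by (subst eval_Add) simp_all
  have [simp]: "eval_op b Add (L + ?q * S) (Suc 0) = adr (?q, 0)" using b1 c1
    by (subst eval_Add) simp_all
  have [simp]: "eval_op b Add (adr (?q, 0)) 0 = adr (?q, 0)" using b1 c1
    by (subst eval_Add) simp_all
  note [simp del] = eval_op.simps
  have [simp]: "2 mod 2 ^ b = (2::nat)" using const_bound[of 2] by simp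
  let ?c = "run b P 7 c"
  have c: "pc ?c = 30" "fixed (reg ?c)" "reg ?c 4 = adr (?q, 0)" "mem ?c = N(adr (?q, 0) := 1)"
    using assms N2 by (simp_all add: exec_simps fixed_def)
  \<comment> \<open>The empty stack is represented by its end marker \<open>1\<close>.\<close>
  have "store {} [] 1 N" using N by (simp add: store_def built_def)
  from push[OF this V] have "store {} [(?q, 0)] (adr (?q, 0)) (N(adr (?q, 0) := 1))" by simp
  then have "state {} {(?q, 0)} ?c" unfolding state_def using c
    by (intro conjI exI[of _ "[(?q, 0)]"]) simp_all
  then show "pc ?c = 30 \<and> state {} {(?q, 0)} ?c" using c by simp
qed

text \<open>Each state occurs at \<open>length w + 1\<close> positions, and the lists of all states
  have total length \<open>m\<close>.\<close>

lemma sum_cost: "(\<Sum>v\<in>V. 16 + 24 * length (out m (fst v))) =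
  Suc (length w) * (16 * card (states A) + 24 * m)"
proof -
  have "(\<Sum>v\<in>V. 16 + 24 * length (out m (fst v))) =
    (\<Sum>q\<in>states A. \<Sum>i\<le>length w. 16 + 24 * length (out m q))"
    unfolding V_def by (subst sum.cartesian_product) (auto intro: sum.cong)
  also have "\<dots> = Suc (length w) * (16 * card (states A) + 24 * m)"
    by (simp add: sum.distrib sum_length_out add_mult_distrib2 flip: sum_distrib_left)
  finally show ?thesis .
qed

text \<open>The \<open>17\<close> is \<open>7 + 1 + 9\<close>: pushing the root, leaving the search
  loop, and looking up the answer.\<close>

lemma search:
  assumes "pc c = 23" "fixed (reg c)" "mem c = N"
  shows "leads b P (Suc (length w) * (16 * card (states A) + 24 * m) + 17) c
    (\<lambda>c'. pc c' = 78 \<and> reg c' 0 = (if matching super A w then 1 else 0))" (is "leads b P ?K c ?Q")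
proof (rule leads_trans[OF push_root[OF assms]])
  let ?v = "(initial A, 0)"
  let ?R = "(product super A w)\<^sup>* `` {?v}"
  fix c1 :: config assume 1: "pc c1 = 30 \<and> state {} {?v} c1"
  show "leads b P (Suc (length w) * (16 * card (states A) + 24 * m) + 10) c1 ?Q"
  proof (rule leads_trans[OF main_loop[of c1 "{}" "{?v}" ?v]])
    fix c2 :: config assume 2: "pc c2 = 69 \<and> (let R = ?R in state R R c2)"
    show "leads b P 9 c2 ?Q"
      using epilogue[of c2 ?R] 2 by (simp add: matching_iff[OF enfa] Let_def)
  qed (use 1 sum_cost in auto)
qed simp

end

section \<open>Total running time\<close>

context machine
begin

text \<open>By \<open>n \<le> m + 1\<close> the second factor is at most \<open>40 * m + 16\<close>,
  hence at most \<open>56 * M\<close>, so the product is at most \<open>112 * (W * M)\<close>. The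
  remaining \<open>41 + 9 * m\<close> is at most \<open>50 * (W * M)\<close>.\<close>

lemma run_time:
  "41 + 9 * m + Suc (length w) * (16 * card (states A) + 24 * m) \<le> 200 * supersequence_bound A w"
proof -
  define W M where "W = max 1 (length w)" and "M = max 1 m"
  have "Suc (length w) \<le> 2 * W" "16 * card (states A) + 24 * m \<le> 56 * M" "1 \<le> W" "1 \<le> M" "m \<le> M"
    using states_le by (auto simp: W_def M_def)
  then have "Suc (length w) * (16 * card (states A) + 24 * m) \<le> 2 * W * (56 * M)"
    by (intro mult_le_mono)
  moreover have "M \<le> W * M" using \<open>1 \<le> W\<close> by (cases W) simp_all
  moreover have "supersequence_bound A w = W * M"
    by (simp add: supersequence_bound_def W_def M_def m_eq)
  moreover have "2 * W * (56 * M) = 112 * (W * M)" by simp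
  ultimately show ?thesis using \<open>m \<le> M\<close> \<open>1 \<le> M\<close> by linarith
qed

lemma answers:
  "answers_within b P (encode A ts w) (matching super A w) (200 * supersequence_bound A w)"
proof -
  let ?Q = "\<lambda>c'. pc c' = 78 \<and> reg c' 0 = (if matching super A w then 1 else 0)"
  have "leads b P (14 + (9 * m + 1 + (Suc (length w) * (16 * card (states A) + 24 * m) + 17)))
    (initial_config (encode A ts w)) ?Q"
  proof (rule leads_trans[OF prologue])
    fix c :: config assume c: "pc c = 14 \<and> fixed (reg c) \<and> reg c 7 = ptr 0 \<and> reg c 14 = 3 \<and>
      built 0 (mem c)"
    have "leads b P (9 * (m - 0) + 1) c (\<lambda>c. pc c = 23 \<and> fixed (reg c) \<and> built m (mem c))"
      using c by (intro build_loop) auto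
    then show "leads b P (9 * m + 1 + (Suc (length w) * (16 * card (states A) + 24 * m) + 17)) c ?Q"
    proof (rule leads_trans)
      fix c' :: config assume c': "pc c' = 23 \<and> fixed (reg c') \<and> built m (mem c')"
      \<comment> \<open>The memory left by the list construction becomes the reference
        \<open>N\<close> of the search.\<close>
      interpret prepared A w ts b super "mem c'" by unfold_locales (use c' in simp)
      show "leads b P (Suc (length w) * (16 * card (states A) + 24 * m) + 17) c' ?Q"
        using c' by (intro search) auto
    qed simp
  qed simp
  then have "leads b P (200 * supersequence_bound A w) (initial_config (encode A ts w)) ?Q"
    by (rule leads_mono) (use run_time in simp)
  then show ?thesis
    by (auto simp: answers_within_def leads_def halted_def length_prog prog_nth Let_def)
qed

end

text \<open>One argument serves both problems, as the search meets the bound for supersequences in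
  either case.\<close>

lemma solvable_matching:
  assumes "\<And>A w. matching_instance A w \<Longrightarrow> supersequence_bound A w \<le> f A w"
  shows "solvable_in_time (matching super) f"
  unfolding solvable_in_time_def
proof (intro exI allI impI)
  \<comment> \<open>The witnesses are \<open>c = 2\<close> and \<open>C = 200\<close>. Twice the
    logarithm of the input length, in bits, suffices for the square of that length.\<close>
  fix A w ts b
  assume inst: "matching_instance A w" "distinct ts" "set ts = delta A"
    and b: "real 2 * log 2 (real (length (encode A ts w))) \<le> real b"
  let ?L = "length (encode A ts w)"
  have pos: "0 < real ?L" by (simp add: length_encode)
  then have "real (?L ^ 2) = (2 powr log 2 (real ?L)) powr 2" by (simp add: powr_numeral)
  also have "\<dots> = 2 powr (real 2 * log 2 (real ?L))" by (simp add: powr_powr mult.commute)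
  also have "\<dots> \<le> 2 powr real b" using b by simp
  also have "\<dots> = real (2 ^ b)" by (simp add: powr_realpow)
  finally have "?L ^ 2 \<le> 2 ^ b" by (simp only: of_nat_le_iff)
  then interpret machine A w ts b super by unfold_locales (use inst in auto)
  show "answers_within b (prog (if super then 1 else 0)) (encode A ts w) (matching super A w) (200 * f A w)"
    using answers assms[OF inst(1)] unfolding answers_within_def flag_def
    by (meson le_trans mult_le_mono2)
qed

theorem theorem3p4:
  shows "solvable_in_time subsequence_matching subsequence_bound \<and>
         solvable_in_time supersequence_matching supersequence_bound"
proof
  \<comment> \<open>Skipping takes at most one edge per node, whatever the alphabet, so subsequence
    matching meets even the smaller bound.\<close>
  have "supersequence_bound A w \<le> subsequence_bound A w" for A :: "(nat, nat) enfa" and w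
    unfolding supersequence_bound_def subsequence_bound_def by (intro mult_le_mono) auto
  then have "solvable_in_time (matching False) subsequence_bound"
    by (rule solvable_matching)
  then show "solvable_in_time subsequence_matching subsequence_bound"
    by (simp add: matching_def[abs_def])
  have "solvable_in_time (matching True) supersequence_bound"
    by (rule solvable_matching) simp
  then show "solvable_in_time supersequence_matching supersequence_bound"
    by (simp add: matching_def[abs_def])
qed

end
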